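(* Let $G$ be a nontrivial additive subgroup of $\mathbb C$. Then $\Delta(\widetilde W(G))=\langle\mathrm{Id}\rangle$; that is, a linear map $\widetilde W(G)\to\widetilde W(G)$ is a $\frac12$-derivation of the Lie algebra $\widetilde W(G)$ if and only if it is a scalar multiple of the identity.
   Context: All vector spaces are over $\mathbb C$. A $\frac12$-derivation of a Lie algebra $\mathfrak L$ is a linear map $\varphi:\mathfrak L\to\mathfrak L$ with $\varphi([x,y])=\frac12([\varphi(x),y]+[x,\varphi(y)])$ for all $x,y$; $\Delta(\mathfrak L)$ is the space of all of them, and $\langle S\rangle$ denotes the $\mathbb C$-span of $S$. $\widetilde W(G)$ is the Lie algebra with basis $\{L_{\alpha,i}\mid\alpha\in G,\ i\in\mathbb Z\}\cup\{C\}$, with $C$ central and $$[L_{\alpha,i},L_{\beta,j}]=(\beta-\alpha)L_{\alpha+\beta,i+j}+(j-i)L_{\alpha+\beta,i+j-1}+\delta_{\alpha,-\beta}\big(\delta_{i+j,-1}\alpha^3+3i\,\delta_{i+j,0}\alpha^2+3i(i-1)\delta_{i+j,1}\alpha+i(i-1)(i-2)\delta_{i+j,2}\big)C.$$ *)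

theory Defs
  imports Complex_Main "HOL-Library.Poly_Mapping" "HOL-Library.Function_Algebras"
begin

section \<open>Complex Lie algebras on a carrier\<close>

text \<open>
  The Lie algebra is the subspace \<open>V\<close> of an ambient complex vector space; nothing is required of the
  bracket outside \<open>V\<close>.
\<close>

locale complex_lie_algebra = vector_space scale
  for scale :: "complex \<Rightarrow> 'v::ab_group_add \<Rightarrow> 'v" (infixr \<open>*s\<close> 75) +
  fixes V :: "'v set" and bracket :: "'v \<Rightarrow> 'v \<Rightarrow> 'v"
  assumes subspace_carrier: "subspace V"
    and bracket_closed: "x \<in> V \<Longrightarrow> y \<in> V \<Longrightarrow> bracket x y \<in> V"
    and bracket_add_left: "x \<in> V \<Longrightarrow> y \<in> V \<Longrightarrow> z \<in> V \<Longrightarrow>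
          bracket (x + y) z = bracket x z + bracket y z"
    and bracket_add_right: "x \<in> V \<Longrightarrow> y \<in> V \<Longrightarrow> z \<in> V \<Longrightarrow>
          bracket x (y + z) = bracket x y + bracket x z"
    and bracket_scale_left: "x \<in> V \<Longrightarrow> y \<in> V \<Longrightarrow> bracket (c *s x) y = c *s bracket x y"
    and bracket_scale_right: "x \<in> V \<Longrightarrow> y \<in> V \<Longrightarrow> bracket x (c *s y) = c *s bracket x y"
    and bracket_self: "x \<in> V \<Longrightarrow> bracket x x = 0"
    and jacobi: "x \<in> V \<Longrightarrow> y \<in> V \<Longrightarrow> z \<in> V \<Longrightarrow>
          bracket x (bracket y z) + bracket y (bracket z x) + bracket z (bracket x y) = 0"
begin

definition linear_endo :: "('v \<Rightarrow> 'v) \<Rightarrow> bool" where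
  "linear_endo \<phi> \<longleftrightarrow>
     (\<forall>x\<in>V. \<phi> x \<in> V) \<and>
     (\<forall>x\<in>V. \<forall>y\<in>V. \<phi> (x + y) = \<phi> x + \<phi> y) \<and>
     (\<forall>c. \<forall>x\<in>V. \<phi> (c *s x) = c *s \<phi> x)"

definition half_derivation :: "('v \<Rightarrow> 'v) \<Rightarrow> bool" where
  "half_derivation \<phi> \<longleftrightarrow>
     linear_endo \<phi> \<and>
     (\<forall>x\<in>V. \<forall>y\<in>V. \<phi> (bracket x y) = (1 / 2) *s (bracket (\<phi> x) y + bracket x (\<phi> y)))"

text \<open>
  A map \<open>V \<rightarrow> V\<close> is represented by its extension by \<open>0\<close> to the ambient space, so that each map has
  exactly one representative and the representatives form a vector space under the pointwise
  operations.
\<close>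

definition half_derivations :: "('v \<Rightarrow> 'v) set" where
  "half_derivations = {\<phi>. half_derivation \<phi> \<and> (\<forall>x. x \<notin> V \<longrightarrow> \<phi> x = 0)}"

definition id_endo :: "'v \<Rightarrow> 'v" where
  "id_endo = (\<lambda>x. if x \<in> V then x else 0)"

definition map_span :: "('v \<Rightarrow> 'v) set \<Rightarrow> ('v \<Rightarrow> 'v) set" where
  "map_span = module.span (\<lambda>c \<phi> x. c *s \<phi> x)"

lemma vector_space_maps: "vector_space (\<lambda>c (\<phi> :: 'v \<Rightarrow> 'v) x. c *s \<phi> x)"
  by standard (simp_all add: fun_eq_iff scale_right_distrib scale_left_distrib)

end


section \<open>Free complex vector spaces\<close>

definition pm_scale :: "complex \<Rightarrow> ('k \<Rightarrow>\<^sub>0 complex) \<Rightarrow> ('k \<Rightarrow>\<^sub>0 complex)" where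
  "pm_scale c f = Poly_Mapping.map ((*) c) f"

definition pm_extend :: "('k \<Rightarrow> ('l \<Rightarrow>\<^sub>0 complex)) \<Rightarrow> ('k \<Rightarrow>\<^sub>0 complex) \<Rightarrow> ('l \<Rightarrow>\<^sub>0 complex)" where
  "pm_extend h f = (\<Sum>k\<in>Poly_Mapping.keys f. pm_scale (Poly_Mapping.lookup f k) (h k))"

lemma lookup_pm_scale [simp]:
  "Poly_Mapping.lookup (pm_scale c f) k = c * Poly_Mapping.lookup f k"
  by (simp add: pm_scale_def Poly_Mapping.map.rep_eq when_def)

global_interpretation pm: vector_space pm_scale
  by standard (auto intro!: poly_mapping_eqI simp: lookup_add algebra_simps)

lemma keys_pm_scale_subset: "Poly_Mapping.keys (pm_scale c f) \<subseteq> Poly_Mapping.keys f"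
  by (auto simp: in_keys_iff)

lemma pm_extend_superset:
  assumes "finite A" "Poly_Mapping.keys f \<subseteq> A"
  shows "pm_extend h f = (\<Sum>k\<in>A. pm_scale (Poly_Mapping.lookup f k) (h k))"
  unfolding pm_extend_def
  by (rule sum.mono_neutral_left) (use assms in \<open>auto simp: in_keys_iff\<close>)

lemma pm_extend_add: "pm_extend h (f + g) = pm_extend h f + pm_extend h g"
proof -
  let ?A = "Poly_Mapping.keys f \<union> Poly_Mapping.keys g"
  have "Poly_Mapping.keys (f + g) \<subseteq> ?A" by (rule Poly_Mapping.keys_add)
  then show ?thesis
    by (simp add: pm_extend_superset[of ?A] lookup_add pm.scale_left_distrib sum.distrib)
qed

lemma pm_extend_scale: "pm_extend h (pm_scale c f) = pm_scale c (pm_extend h f)"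
  using keys_pm_scale_subset[of c f]
  by (simp add: pm_extend_superset[of "Poly_Mapping.keys f"] pm.scale_sum_right)

lemma pm_extend_single [simp]: "pm_extend h (Poly_Mapping.single k c) = pm_scale c (h k)"
  by (simp add: pm_extend_superset[of "{k}"])

lemma pm_extend_zero [simp]: "pm_extend h 0 = 0"
  by (simp add: pm_extend_def)

lemma pm_extend_fun_add: "pm_extend (\<lambda>k. h k + h' k) f = pm_extend h f + pm_extend h' f"
  by (simp add: pm_extend_def pm.scale_right_distrib sum.distrib)

lemma pm_extend_fun_scale: "pm_extend (\<lambda>k. pm_scale c (h k)) f = pm_scale c (pm_extend h f)"
  by (simp add: pm_extend_def pm.scale_sum_right mult.commute)

lemma pm_extend_fun_zero [simp]: "pm_extend (\<lambda>k. 0) f = 0"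
  by (simp add: pm_extend_def)

lemma pm_expansion:
  "f = (\<Sum>k\<in>Poly_Mapping.keys f. pm_scale (Poly_Mapping.lookup f k) (Poly_Mapping.single k 1))"
  by (rule poly_mapping_eqI)
     (auto simp: lookup_sum lookup_single when_def in_keys_iff if_distrib cong: if_cong)

lemma pm_induct [case_names add scale basis]:
  assumes "\<And>f g. P f \<Longrightarrow> P g \<Longrightarrow> P (f + g)" "\<And>c f. P f \<Longrightarrow> P (pm_scale c f)"
    and basis: "\<And>k. P (Poly_Mapping.single k (1 :: complex))"
  shows "P f"
proof -
  have "P 0" using assms(2)[OF basis, of 0] by simp
  have "P (\<Sum>k\<in>A. pm_scale (Poly_Mapping.lookup f k) (Poly_Mapping.single k 1))" if "finite A" for A
    using that by induction (auto intro: assms \<open>P 0\<close>)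
  then show ?thesis by (subst pm_expansion) simp
qed


section \<open>The Lie algebra\<close>

text \<open>
  Basis labels. The label type admits every complex \<open>\<alpha>\<close>; the restriction to \<open>\<alpha> \<in> G\<close> is made in the
  carrier.
\<close>

datatype W_index = L_idx complex int | C_idx

definition L :: "complex \<Rightarrow> int \<Rightarrow> (W_index \<Rightarrow>\<^sub>0 complex)" where
  "L \<alpha> i = Poly_Mapping.single (L_idx \<alpha> i) 1"

definition C :: "W_index \<Rightarrow>\<^sub>0 complex" where
  "C = Poly_Mapping.single C_idx 1"

definition W_cocycle :: "complex \<Rightarrow> int \<Rightarrow> complex \<Rightarrow> int \<Rightarrow> complex" where
  "W_cocycle \<alpha> i \<beta> j =
     of_bool (\<alpha> = - \<beta>) *
       (of_bool (i + j = -1) * \<alpha> ^ 3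
        + 3 * of_int i * of_bool (i + j = 0) * \<alpha> ^ 2
        + 3 * of_int (i * (i - 1)) * of_bool (i + j = 1) * \<alpha>
        + of_int (i * (i - 1) * (i - 2)) * of_bool (i + j = 2))"

fun W_basis_bracket :: "W_index \<Rightarrow> W_index \<Rightarrow> (W_index \<Rightarrow>\<^sub>0 complex)" where
  "W_basis_bracket (L_idx \<alpha> i) (L_idx \<beta> j) =
     pm_scale (\<beta> - \<alpha>) (L (\<alpha> + \<beta>) (i + j))
     + pm_scale (of_int (j - i)) (L (\<alpha> + \<beta>) (i + j - 1))
     + pm_scale (W_cocycle \<alpha> i \<beta> j) C"
| "W_basis_bracket C_idx _ = 0"
| "W_basis_bracket _ C_idx = 0"

definition W_bracket ::
  "(W_index \<Rightarrow>\<^sub>0 complex) \<Rightarrow> (W_index \<Rightarrow>\<^sub>0 complex) \<Rightarrow> (W_index \<Rightarrow>\<^sub>0 complex)" where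
  "W_bracket f g = pm_extend (\<lambda>a. pm_extend (W_basis_bracket a) g) f"

definition W_carrier :: "complex set \<Rightarrow> (W_index \<Rightarrow>\<^sub>0 complex) set" where
  "W_carrier G = pm.span ({L \<alpha> i | \<alpha> i. \<alpha> \<in> G} \<union> {C})"

lemma W_bracket_L_L:
  "W_bracket (L \<alpha> i) (L \<beta> j) =
     pm_scale (\<beta> - \<alpha>) (L (\<alpha> + \<beta>) (i + j))
     + pm_scale (of_int (j - i)) (L (\<alpha> + \<beta>) (i + j - 1))
     + pm_scale (W_cocycle \<alpha> i \<beta> j) C"
  by (simp add: W_bracket_def L_def)

lemma W_bracket_add_left: "W_bracket (f + f') g = W_bracket f g + W_bracket f' g"
  by (simp add: W_bracket_def pm_extend_add)

lemma W_bracket_add_right: "W_bracket f (g + g') = W_bracket f g + W_bracket f g'"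
  by (simp add: W_bracket_def pm_extend_add pm_extend_fun_add)

lemma W_bracket_scale_left: "W_bracket (pm_scale c f) g = pm_scale c (W_bracket f g)"
  by (simp add: W_bracket_def pm_extend_scale)

lemma W_bracket_scale_right: "W_bracket f (pm_scale c g) = pm_scale c (W_bracket f g)"
  by (simp add: W_bracket_def pm_extend_scale pm_extend_fun_scale)

lemma W_bracket_zero [simp]: "W_bracket 0 g = 0" "W_bracket f 0 = 0"
  by (simp_all add: W_bracket_def)

lemmas W_bracket_bilinear =
  W_bracket_add_left W_bracket_add_right W_bracket_scale_left W_bracket_scale_right

lemma W_bracket_single:
  "W_bracket (Poly_Mapping.single a 1) (Poly_Mapping.single b 1) = W_basis_bracket a b"
  by (simp add: W_bracket_def)

lemma W_bracket_C [simp]: "W_bracket C f = 0" "W_bracket f C = 0"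
proof -
  have [simp]: "W_basis_bracket a C_idx = 0" for a by (cases a) auto
  have [simp]: "W_basis_bracket C_idx = (\<lambda>_. 0)" by (rule ext) simp
  show "W_bracket C f = 0" "W_bracket f C = 0"
    by (simp_all add: W_bracket_def C_def)
qed

lemma W_cocycle_eq_0: "\<alpha> + \<beta> \<noteq> 0 \<Longrightarrow> W_cocycle \<alpha> i \<beta> j = 0"
  by (auto simp: W_cocycle_def)

lemma W_cocycle_antisym: "W_cocycle \<beta> j \<alpha> i = - W_cocycle \<alpha> i \<beta> j"
proof (cases "\<alpha> = - \<beta>")
  case True
  define s where "s = i + j"
  have j: "j = s - i" by (simp add: s_def)
  consider "s = -1" | "s = 0" | "s = 1" | "s = 2" | "s \<notin> {-1, 0, 1, 2}" by blast
  then show ?thesis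
    by cases (simp_all add: True j W_cocycle_def algebra_simps power2_eq_square power3_eq_cube)
next
  case False
  then have "\<beta> \<noteq> - \<alpha>" by auto
  then show ?thesis using False by (simp add: W_cocycle_def)
qed

lemma W_basis_bracket_antisym: "W_basis_bracket b a = - W_basis_bracket a b"
proof (cases a; cases b)
  fix \<alpha> i \<beta> j assume "a = L_idx \<alpha> i" "b = L_idx \<beta> j"
  then show ?thesis
    by (simp add: W_cocycle_antisym[of \<beta> j \<alpha> i] add.commute[of \<beta>] add.commute[of j]
          pm.scale_left_diff_distrib)
qed auto

lemma W_bracket_antisym: "W_bracket g f = - W_bracket f g"
proof (induction f rule: pm_induct)
  case (basis a)
  show ?case
  proof (induction g rule: pm_induct)
    case (basis b)
    show ?case by (simp add: W_bracket_single W_basis_bracket_antisym[of b a])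
  qed (simp_all add: W_bracket_bilinear)
qed (simp_all add: W_bracket_bilinear)

lemma W_bracket_self: "W_bracket f f = 0"
proof (rule poly_mapping_eqI)
  fix k
  have "Poly_Mapping.lookup (W_bracket f f) k = - Poly_Mapping.lookup (W_bracket f f) k"
    by (metis W_bracket_antisym lookup_uminus)
  then show "Poly_Mapping.lookup (W_bracket f f) k = Poly_Mapping.lookup 0 k"
    by (simp add: eq_neg_iff_add_eq_0)
qed

lemma W_cocycle_jacobi:
  fixes a b c :: complex and i j k :: int
  defines "T \<equiv> (\<lambda>a i b j c k. (c - b) * W_cocycle a i (b + c) (j + k)
                 + of_int (k - j) * W_cocycle a i (b + c) (j + k - 1))"
  shows "T a i b j c k + T b j c k a i + T c k a i b j = 0"
proof (cases "a + b + c = 0")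
  case True
  then have c: "c = - a - b" by (simp add: algebra_simps eq_neg_iff_add_eq_0)
  define s where "s = i + j + k"
  have k: "k = s - i - j" by (simp add: s_def)
  consider "s = -1" | "s = 0" | "s = 1" | "s = 2" | "s = 3" | "s \<notin> {-1,0,1,2,3}" by blast
  then show ?thesis
    by cases (simp_all add: T_def W_cocycle_def c k,
                 simp_all add: algebra_simps power2_eq_square power3_eq_cube)
next
  case False
  then have "a + (b + c) \<noteq> 0" "b + (c + a) \<noteq> 0" "c + (a + b) \<noteq> 0"
    by (simp_all add: add_ac)
  from this[THEN W_cocycle_eq_0] show ?thesis by (simp add: T_def)
qed

lemma W_jacobi_L:
  "W_bracket (L a i) (W_bracket (L b j) (L c k)) + W_bracket (L b j) (W_bracket (L c k) (L a i))
     + W_bracket (L c k) (W_bracket (L a i) (L b j)) = 0"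
proof -
  let ?x = "L (a + b + c) (i + j + k)" and ?y = "L (a + b + c) (i + j + k - 1)"
    and ?z = "L (a + b + c) (i + j + k - 2)"
  let ?T = "\<lambda>a i b j c k. (c - b) * W_cocycle a i (b + c) (j + k)
                 + of_int (k - j) * W_cocycle a i (b + c) (j + k - 1)"
  let ?X = "\<lambda>a b c. (c - b) * (b + c - a)"
  let ?Y = "\<lambda>a i b j c k. (c - b) * of_int (j + k - i) + of_int (k - j) * (b + c - a)"
  let ?Z = "\<lambda>i j k. of_int (k - j) * of_int (j + k - 1 - i) :: complex"
  have *: "W_bracket (L a i) (W_bracket (L b j) (L c k)) =
      pm_scale (?X a b c) (L (a + b + c) (i + j + k))
      + pm_scale (?Y a i b j c k) (L (a + b + c) (i + j + k - 1))
      + pm_scale (?Z i j k) (L (a + b + c) (i + j + k - 2))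
      + pm_scale (?T a i b j c k) C" for a b c i j k
  proof -
    have "a + (b + c) = a + b + c" "i + (j + k) = i + j + k"
      "i + (j + k - 1) = i + j + k - 1" "i + (j + k - 1) - 1 = i + j + k - 2"
      by simp_all
    then show ?thesis
      by (simp add: W_bracket_L_L W_bracket_bilinear pm.scale_right_distrib
           pm.scale_left_distrib add.assoc add_diff_eq del: of_int_diff of_int_add)
  qed
  have cyc: "b + c + a = a + b + c" "c + a + b = a + b + c"
    "j + k + i = i + j + k" "k + i + j = i + j + k" by simp_all
  have coeffs: "?X a b c + ?X b c a + ?X c a b = 0"
    "?Y a i b j c k + ?Y b j c k a i + ?Y c k a i b j = 0"
    "?Z i j k + ?Z j k i + ?Z k i j = 0"
    by (simp_all add: algebra_simps)
  have central: "?T a i b j c k + ?T b j c k a i + ?T c k a i b j = 0"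
    by (rule W_cocycle_jacobi)
  have collect: "(pm_scale x1 p + pm_scale y1 q + pm_scale z1 r + pm_scale t1 s)
     + (pm_scale x2 p + pm_scale y2 q + pm_scale z2 r + pm_scale t2 s)
     + (pm_scale x3 p + pm_scale y3 q + pm_scale z3 r + pm_scale t3 s) =
     pm_scale (x1 + x2 + x3) p + pm_scale (y1 + y2 + y3) q + pm_scale (z1 + z2 + z3) r
     + pm_scale (t1 + t2 + t3) s" for x1 x2 x3 y1 y2 y3 z1 z2 z3 t1 t2 t3
       and p q r s :: "W_index \<Rightarrow>\<^sub>0 complex"
    by (simp add: pm.scale_left_distrib add_ac)
  show ?thesis
    unfolding * cyc collect coeffs central by simp
qed

lemma W_jacobi:
  "W_bracket f (W_bracket g h) + W_bracket g (W_bracket h f) + W_bracket h (W_bracket f g) = 0"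
proof -
  have add: "x1 + y1 + z1 = 0 \<Longrightarrow> x2 + y2 + z2 = 0 \<Longrightarrow> x1 + x2 + (y1 + y2) + (z1 + z2) = 0"
    for x1 x2 y1 y2 z1 z2 :: "W_index \<Rightarrow>\<^sub>0 complex"
    by (metis (no_types, lifting) add.assoc add.left_commute add.right_neutral)
  have scale: "x + y + z = 0 \<Longrightarrow> pm_scale c x + pm_scale c y + pm_scale c z = 0"
    for x y z :: "W_index \<Rightarrow>\<^sub>0 complex" and c
    by (metis pm.scale_right_distrib pm.scale_zero_right)
  have single: "Poly_Mapping.single a 1 = (case a of L_idx \<alpha> i \<Rightarrow> L \<alpha> i | C_idx \<Rightarrow> C)" for a
    by (cases a) (simp_all add: L_def C_def)
  show ?thesis
  proof (induction f rule: pm_induct)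
    case (basis a)
    show ?case
    proof (induction g rule: pm_induct)
      case (basis b)
      show ?case
      proof (induction h rule: pm_induct)
        case (basis c)
        show ?case
          using W_jacobi_L by (auto simp: single split: W_index.splits)
      qed (simp_all only: W_bracket_bilinear add scale)
    qed (simp_all only: W_bracket_bilinear add scale)
  qed (simp_all only: W_bracket_bilinear add scale)
qed

lemma W_bracket_closed:
  assumes G: "\<And>\<alpha> \<beta>. \<alpha> \<in> G \<Longrightarrow> \<beta> \<in> G \<Longrightarrow> \<alpha> + \<beta> \<in> G"
    and f: "f \<in> W_carrier G" and g: "g \<in> W_carrier G"
  shows "W_bracket f g \<in> W_carrier G"
proof -
  let ?B = "{L \<alpha> i | \<alpha> i. \<alpha> \<in> G} \<union> {C}"
  have base: "L \<alpha> i \<in> pm.span ?B" if "\<alpha> \<in> G" for \<alpha> i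
    by (rule pm.span_base) (use that in auto)
  have baseC: "C \<in> pm.span ?B"
    by (rule pm.span_base) auto
  have basis: "W_bracket x y \<in> pm.span ?B" if x: "x \<in> ?B" and y: "y \<in> ?B" for x y
  proof (cases "x = C \<or> y = C")
    case True
    then show ?thesis by (auto simp: pm.span_zero)
  next
    case False
    then obtain \<alpha> i \<beta> j where "x = L \<alpha> i" "y = L \<beta> j" "\<alpha> \<in> G" "\<beta> \<in> G"
      using x y by auto
    then show ?thesis
      by (simp only: W_bracket_L_L) (intro pm.span_add pm.span_scale base baseC G)
  qed
  have right: "W_bracket x y \<in> pm.span ?B" if x: "x \<in> ?B" and y: "y \<in> pm.span ?B" for x y
    using y
  proof (induction rule: pm.span_induct_alt)
    case (step c y z)
    show ?case
      unfolding W_bracket_bilinear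
      by (rule pm.span_add[OF pm.span_scale[OF basis[OF x step(1)]] step(2)])
  qed (simp add: pm.span_zero)
  have "W_bracket f g \<in> pm.span ?B"
    using f[unfolded W_carrier_def]
  proof (induction rule: pm.span_induct_alt)
    case (step c x z)
    show ?case
      unfolding W_bracket_bilinear
      by (rule pm.span_add[OF pm.span_scale[OF right[OF step(1) g[unfolded W_carrier_def]]] step(2)])
  qed (simp add: pm.span_zero)
  then show ?thesis by (simp add: W_carrier_def)
qed

lemma independent_W_basis:
  "pm.independent ({L \<alpha> i | \<alpha> i. \<alpha> \<in> G} \<union> {C})"
proof -
  let ?s = "\<lambda>k :: W_index. Poly_Mapping.single k (1 :: complex)"
  have inj: "?s k = ?s l \<longleftrightarrow> k = l" for k l
    by (metis lookup_single_eq lookup_single_not_eq zero_neq_one)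
  have "pm.independent (range ?s)"
    unfolding pm.independent_explicit_module
  proof (intro allI impI)
    fix t u v
    assume t: "finite t" "t \<subseteq> range ?s" "(\<Sum>v\<in>t. pm_scale (u v) v) = 0" "v \<in> t"
    then obtain k where k: "v = ?s k" by auto
    have "Poly_Mapping.lookup (\<Sum>v\<in>t. pm_scale (u v) v) k
        = (\<Sum>w\<in>t. if w = v then u v else 0)"
      unfolding lookup_sum
      by (rule sum.cong) (use t(2) k inj in \<open>auto simp: lookup_single when_def\<close>)
    also have "\<dots> = u v" using t by simp
    finally show "u v = 0" using t by simp
  qed
  then show ?thesis
    by (rule pm.independent_mono) (auto simp: L_def C_def)
qed

theorem complex_lie_algebra_W:
  assumes "\<And>\<alpha> \<beta>. \<alpha> \<in> G \<Longrightarrow> \<beta> \<in> G \<Longrightarrow> \<alpha> + \<beta> \<in> G"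
  shows "complex_lie_algebra pm_scale (W_carrier G) W_bracket"
proof
  show "pm.subspace (W_carrier G)" by (simp add: W_carrier_def)
qed (use assms in \<open>simp_all add: W_bracket_bilinear W_bracket_self W_jacobi W_bracket_closed\<close>)

end

theory Submission
  imports Defs "HOL-Library.Product_Plus"
begin

text \<open>
  Identify \<open>L \<alpha> i\<close> with the function \<open>e\<^bsup>\<alpha>t\<^esup> t\<^bsup>i\<^esup>\<close>. With \<open>D = d/dt\<close> and \<open>res\<close> the coefficient of
  \<open>t\<^bsup>-1\<^esup>\<close>, the bracket becomes \<open>[f, g] = f D g - D f g + res (D\<^sup>3 f g) C\<close>, and \<open>res\<close> vanishes on
  derivatives. A half-derivation sends \<open>C\<close> to a central element \<open>c C\<close>, and \<open>f\<close> to \<open>P f + \<omega> f C\<close>.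

  Modulo the centre, multiplication by \<open>a = P 1\<close> is a half-derivation, so \<open>\<psi> = P - a\<close> is one that
  kills \<open>1\<close>. Then \<open>2 \<psi> D = D \<psi>\<close>, which puts \<open>\<psi> e\<^bsup>\<alpha>t\<^esup>\<close> into the span of \<open>e\<^bsup>2\<alpha>t\<^esup>\<close>, and bracketing with
  \<open>e\<^bsup>-\<alpha>t\<^esup>\<close> kills it. Applying \<open>\<psi>\<close> to
  \<open>[e\<^bsup>\<alpha>t\<^esup>, [e\<^bsup>-\<alpha>t\<^esup>, g]] = (D - 2\<alpha>)(D + \<alpha>) g\<close> yields \<open>D (\<psi> g) = - 6 \<alpha> \<psi> g\<close> for all nonzero
  \<open>\<alpha> \<in> G\<close>; comparing \<open>\<alpha>\<close> with \<open>- \<alpha>\<close> gives \<open>\<psi> = 0\<close>.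

  Reading off the central components for the same double bracket gives, after integration by parts,
  \<open>- 4 \<alpha>\<^sup>2 \<omega> g + 2 c \<alpha>\<^sup>4 res g = res ((\<alpha>\<^sup>3 D a - \<alpha> D\<^sup>3 a + 2 \<alpha>\<^sup>4 a) g)\<close>. Comparing the values
  \<open>\<plusminus>\<alpha>\<close> and \<open>\<plusminus>2\<alpha>\<close> forces \<open>D a = 0\<close>, then \<open>a = c\<close> and \<open>\<omega> = 0\<close>.
\<close>

section \<open>Exponential Laurent polynomials\<close>

type_synonym exp_laurent = "complex \<times> int \<Rightarrow>\<^sub>0 complex"

text \<open>Index \<open>0\<close> is the exponent pair \<open>(0, 0)\<close>, so
  \<open>const\<close> embeds the scalars into the ring; scaling becomes multiplication and
  \<open>algebra_simps\<close> applies.\<close>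

definition const :: "complex \<Rightarrow> exp_laurent" where
  "const c = Poly_Mapping.single 0 c"

definition expo :: "complex \<Rightarrow> exp_laurent" where
  "expo \<alpha> = Poly_Mapping.single (\<alpha>, 0) 1"

definition D :: "exp_laurent \<Rightarrow> exp_laurent" where
  "D = pm_extend (\<lambda>(\<alpha>, i). Poly_Mapping.single (\<alpha>, i) \<alpha> + Poly_Mapping.single (\<alpha>, i - 1) (of_int i))"

text \<open>For \<open>\<alpha> \<noteq> 0\<close> the term \<open>e^(\<alpha> t) / t\<close>
  contributes nothing, unlike for the analytic residue; this matches the factor
  \<open>of_bool (\<alpha> = - \<beta>)\<close> in \<open>W_cocycle\<close>.\<close>

definition res :: "exp_laurent \<Rightarrow> complex" where
  "res f = Poly_Mapping.lookup f (0, -1)"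

lemma pm_scale_eq_const_mult: "pm_scale c f = const c * f"
  by (simp add: pm_scale_def const_def mult_map_scale_conv_mult)

lemma lookup_const_mult [simp]:
  "Poly_Mapping.lookup (const c * f) k = c * Poly_Mapping.lookup f k"
  by (simp flip: pm_scale_eq_const_mult)

lemma const_add: "const (c + d) = const c + const d"
  by (simp add: const_def single_add)

lemma const_diff: "const (c - d) = const c - const d"
  by (simp add: const_def single_diff)

lemma const_uminus: "const (- c) = - const c"
  by (simp add: const_def single_uminus)

lemma const_mult: "const (c * d) = const c * const d"
  by (simp add: const_def mult_single)

lemma const_power: "const (c ^ n) = const c ^ n"
  by (induction n) (simp_all add: const_mult, simp add: const_def)

lemma const_1 [simp]: "const 1 = 1"
  by (simp add: const_def)

lemma const_0 [simp]: "const 0 = 0"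
  by (simp add: const_def)

lemma const_numeral: "const (numeral n) = numeral n"
  by (simp add: const_def)

lemmas const_hom = const_add const_diff const_uminus const_mult const_power const_numeral

lemma const_mult_eq_0_iff [simp]: "const c * f = 0 \<longleftrightarrow> c = 0 \<or> f = 0"
  using pm.scale_eq_0_iff[of c f] by (simp add: pm_scale_eq_const_mult)

lemma expo_0 [simp]: "expo 0 = 1"
  by (simp add: expo_def flip: zero_prod_def)

lemma expo_add: "expo (\<alpha> + \<beta>) = expo \<alpha> * expo \<beta>"
  by (simp add: expo_def mult_single)

lemma expo_mult_cancel: "expo \<alpha> * expo (- \<alpha>) = 1"
  by (simp flip: expo_add)

lemma D_single:
  "D (Poly_Mapping.single (\<alpha>, i) c) = Poly_Mapping.single (\<alpha>, i) (c * \<alpha>) + Poly_Mapping.single (\<alpha>, i - 1) (c * of_int i)"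
  by (simp add: D_def pm_scale_eq_const_mult distrib_left const_def mult_single)

lemma D_add: "D (f + g) = D f + D g"
  by (simp add: D_def pm_extend_add)

lemma D_const_mult: "D (const c * f) = const c * D f"
  by (simp add: D_def pm_extend_scale flip: pm_scale_eq_const_mult)

lemma D_mult: "D (f * g) = D f * g + f * D g"
proof (induction f rule: pm_induct)
  case (basis k)
  show ?case
  proof (induction g rule: pm_induct)
    case (basis l)
    obtain \<alpha> i \<beta> j where "k = (\<alpha>, i)" "l = (\<beta>, j)" by (metis surj_pair)
    then show ?case
      by (simp add: D_single mult_single algebra_simps flip: single_add)
  next
    case (scale c g)
    then show ?case
      by (simp add: pm_scale_eq_const_mult D_const_mult mult.left_commute[of _ "const c"] flip: distrib_left)
  qed (simp add: D_add distrib_left distrib_right add_ac)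
next
  case (scale c f)
  then show ?case
    by (simp add: pm_scale_eq_const_mult D_const_mult mult.assoc mult.left_commute[of _ "const c"] flip: distrib_left)
qed (simp_all add: D_add distrib_left distrib_right add_ac)

lemma D_0 [simp]: "D 0 = 0"
  by (simp add: D_def)

lemma D_const [simp]: "D (const c) = 0"
  by (simp add: const_def D_single zero_prod_def)

lemma D_1 [simp]: "D 1 = 0"
  using D_const[of 1] by simp

lemma D_numeral [simp]: "D (numeral n) = 0"
  using D_const[of "numeral n"] by (simp add: const_numeral)

lemma D_uminus: "D (- f) = - D f"
  by (metis D_0 D_add add.right_inverse add_eq_0_iff)

lemma D_diff: "D (f - g) = D f - D g"
  using D_add[of f "- g"] by (simp add: D_uminus)

lemma D_expo: "D (expo \<alpha>) = const \<alpha> * expo \<alpha>"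
  by (simp add: expo_def const_def D_single mult_single)

lemmas D_rules = D_add D_uminus D_diff D_mult D_const D_1 D_0 D_expo

lemma lookup_D:
  "Poly_Mapping.lookup (D f) (\<beta>, j) = \<beta> * Poly_Mapping.lookup f (\<beta>, j)
     + of_int (j + 1) * Poly_Mapping.lookup f (\<beta>, j + 1)"
proof (induction f rule: pm_induct)
  case (scale c f)
  then show ?case
    by (simp add: pm_scale_eq_const_mult D_const_mult distrib_left mult.left_commute)
next
  case (basis k)
  then show ?case
    by (cases k) (auto simp: D_single lookup_add lookup_single when_def)
qed (simp add: D_add lookup_add algebra_simps)

text \<open>Finiteness of the support excludes all terms with exponent other than \<open>\<mu>\<close>: they would
  propagate to arbitrarily high powers of \<open>t\<close>.\<close>

lemma D_eigenvector:
  assumes "D f = const \<mu> * f"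
  obtains k where "f = const k * expo \<mu>"
proof -
  let ?l = "\<lambda>\<beta> j. Poly_Mapping.lookup f (\<beta>, j)"
  have rec: "of_int (j + 1) * ?l \<beta> (j + 1) = (\<mu> - \<beta>) * ?l \<beta> j" for \<beta> j
    using lookup_D[of f \<beta> j] by (simp add: assms left_diff_distrib)
  have 1: "?l \<beta> j = 0" if "\<beta> \<noteq> \<mu>" for \<beta> j
  proof (rule ccontr)
    assume nz: "?l \<beta> j \<noteq> 0"
    have "?l \<beta> (j + int n) \<noteq> 0" for n
    proof (induction n)
      case (Suc n)
      then have "(\<mu> - \<beta>) * ?l \<beta> (j + int n) \<noteq> 0" using that by simp
      then have "?l \<beta> (j + int n + 1) \<noteq> 0"
        unfolding rec[symmetric] by simp
      then show ?case by (simp add: add_ac)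
    qed (use nz in simp)
    then have "range (\<lambda>n. (\<beta>, j + int n)) \<subseteq> Poly_Mapping.keys f"
      by (auto simp: in_keys_iff)
    moreover have "infinite (range (\<lambda>n. (\<beta>, j + int n)))"
      using finite_imageD[of "\<lambda>n. (\<beta>, j + int n)" UNIV] by (auto simp: inj_on_def)
    ultimately show False
      using finite_subset finite_keys by blast
  qed
  \<comment> \<open>For \<open>\<beta> = \<mu>\<close> the right side of \<open>rec\<close> is zero,
    so only the power \<open>t^0\<close> survives.\<close>
  have 2: "?l \<mu> j = 0" if "j \<noteq> 0" for j
    using rec[of "j - 1" \<mu>] that by simp
  have "f = const (?l \<mu> 0) * expo \<mu>"
  proof (rule poly_mapping_eqI)
    fix k :: "complex \<times> int"
    obtain \<beta> j where k: "k = (\<beta>, j)" by (cases k)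
    show "Poly_Mapping.lookup f k = Poly_Mapping.lookup (const (?l \<mu> 0) * expo \<mu>) k"
      using 1[of \<beta> j] 2[of j] by (auto simp: k expo_def lookup_single when_def)
  qed
  then show ?thesis by (rule that)
qed

section \<open>Residues and integration by parts\<close>

lemma res_add: "res (f + g) = res f + res g"
  by (simp add: res_def lookup_add)

lemma res_diff: "res (f - g) = res f - res g"
  by (simp add: res_def lookup_minus)

lemma res_0 [simp]: "res 0 = 0"
  by (simp add: res_def)

lemma res_const_mult: "res (const c * f) = c * res f"
  by (simp add: res_def)

text \<open>At the index \<open>(0, -1)\<close> both factors \<open>\<beta>\<close> and
  \<open>j + 1\<close> in \<open>lookup_D\<close> are zero.\<close>

lemma res_D [simp]: "res (D f) = 0"
  by (simp add: res_def lookup_D)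

lemma res_D_mult: "res (D f * g) = - res (f * D g)"
  using res_D[of "f * g"] by (simp add: D_mult res_add eq_neg_iff_add_eq_0)

lemma lookup_mult_single:
  fixes f :: exp_laurent
  shows "Poly_Mapping.lookup (f * Poly_Mapping.single k 1) l = Poly_Mapping.lookup f (l - k)"
proof (induction f rule: pm_induct)
  case (scale c f)
  then show ?case
    by (simp add: pm_scale_eq_const_mult mult.assoc)
next
  case (basis m)
  then show ?case
    by (auto simp: mult_single lookup_single when_def)
qed (simp add: lookup_add distrib_right)

section \<open>The bracket as a central extension of a Wronskian\<close>

text \<open>Every element of the ambient space is \<open>vec f s\<close> for exactly one pair
  (\<open>vec_proj_central\<close>, \<open>vec_eq_iff\<close>), so \<open>proj\<close> and
  \<open>central\<close> serve as coordinates.\<close>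

definition vec :: "exp_laurent \<Rightarrow> complex \<Rightarrow> (W_index \<Rightarrow>\<^sub>0 complex)" where
  "vec f s = pm_extend (\<lambda>(\<alpha>, i). L \<alpha> i) f + pm_scale s C"

definition proj :: "(W_index \<Rightarrow>\<^sub>0 complex) \<Rightarrow> exp_laurent" where
  "proj = pm_extend (\<lambda>k. case k of L_idx \<alpha> i \<Rightarrow> Poly_Mapping.single (\<alpha>, i) 1 | C_idx \<Rightarrow> 0)"

abbreviation central :: "(W_index \<Rightarrow>\<^sub>0 complex) \<Rightarrow> complex" where
  "central w \<equiv> Poly_Mapping.lookup w C_idx"

lemma vec_add: "vec f s + vec g t = vec (f + g) (s + t)"
  by (simp add: vec_def pm_extend_add pm.scale_left_distrib)

lemma vec_scale: "pm_scale c (vec f s) = vec (const c * f) (c * s)"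
  by (simp add: vec_def pm_extend_scale pm.scale_right_distrib flip: pm_scale_eq_const_mult)

lemma vec_single: "vec (Poly_Mapping.single (\<alpha>, i) c) s = pm_scale c (L \<alpha> i) + pm_scale s C"
  by (simp add: vec_def)

lemma vec_0: "vec 0 s = pm_scale s C"
  by (simp add: vec_def)

lemma proj_add: "proj (v + w) = proj v + proj w"
  by (simp add: proj_def pm_extend_add)

lemma proj_scale: "proj (pm_scale c w) = const c * proj w"
  by (simp add: proj_def pm_extend_scale pm_scale_eq_const_mult)

lemma proj_L: "proj (L \<alpha> i) = Poly_Mapping.single (\<alpha>, i) 1"
  by (simp add: proj_def L_def)

lemma proj_C [simp]: "proj C = 0"
  by (simp add: proj_def C_def)

lemma vec_proj_central: "vec (proj w) (central w) = w"
proof (induction w rule: pm_induct)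
  case (add v w)
  then show ?case by (simp add: proj_add lookup_add flip: vec_add)
next
  case (scale c w)
  then show ?case by (simp add: proj_scale flip: vec_scale)
next
  case (basis k)
  then show ?case
    by (cases k) (simp_all add: proj_L vec_single vec_0 lookup_single flip: L_def C_def,
                  simp_all add: L_def C_def lookup_single)
qed

lemma proj_vec [simp]: "proj (vec f s) = f"
proof -
  have "proj (vec f 0) = f"
  proof (induction f rule: pm_induct)
    case (add f g)
    then show ?case using vec_add[of f 0 g 0] by (metis add.right_neutral proj_add)
  next
    case (scale c f)
    then show ?case using vec_scale[of c f 0] by (metis mult_zero_right pm_scale_eq_const_mult proj_scale)
  next
    case (basis k)
    then show ?case by (cases k) (simp add: vec_single proj_L)
  qed
  then show ?thesis
    using vec_add[of f 0 0 s]
    by (metis add.left_neutral add.right_neutral mult_zero_right proj_C proj_add proj_scale vec_0)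
qed

text \<open>Reassembling \<open>vec f s\<close> from its coordinates gives
  \<open>vec f (central (vec f s))\<close>, so both carry the same multiple of
  \<open>C\<close>.\<close>

lemma central_vec [simp]: "central (vec f s) = s"
proof -
  have "vec f s - vec f (central (vec f s)) = 0"
    by (metis diff_self proj_vec vec_proj_central)
  then have "pm_scale (s - central (vec f s)) C = 0"
    by (simp add: vec_def pm.scale_left_diff_distrib)
  then show ?thesis
    unfolding C_def using lookup_pm_scale[of _ "Poly_Mapping.single C_idx 1" C_idx]
    by (metis eq_iff_diff_eq_0 lookup_single_eq lookup_zero mult.right_neutral)
qed

lemma vec_eq_iff [simp]: "vec f s = vec g t \<longleftrightarrow> f = g \<and> s = t"
  by (metis proj_vec central_vec)

text \<open>By bilinearity it suffices to take basis elements. There the four terms of the third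
  derivative of \<open>e^(\<alpha> t) t^i\<close> are those of \<open>W_cocycle\<close>, and the
  residue selects \<open>i + j\<close> in \<open>{-1, 0, 1, 2}\<close>.\<close>

lemma W_bracket_vec:
  "W_bracket (vec f s) (vec g t) = vec (f * D g - D f * g) (res (D (D (D f)) * g))"
proof -
  have red: "W_bracket (vec f s) (vec g t) = W_bracket (vec f 0) (vec g 0)"
    by (simp add: vec_def W_bracket_bilinear)
  have "W_bracket (vec f 0) (vec g 0) = vec (f * D g - D f * g) (res (D (D (D f)) * g))"
  proof (induction f rule: pm_induct)
    case (add f h)
    have sum: "vec (f + h) 0 = vec f 0 + vec h 0" by (simp add: vec_add)
    show ?case
      unfolding sum W_bracket_bilinear add
      by (simp add: vec_add D_add res_add distrib_left distrib_right add_diff_add)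
  next
    case (scale c f)
    have scaled: "vec (const c * f) 0 = pm_scale c (vec f 0)" by (simp add: vec_scale)
    show ?case
      unfolding pm_scale_eq_const_mult[of c f] scaled W_bracket_bilinear scale
      by (simp add: vec_scale D_const_mult
            res_const_mult mult.assoc right_diff_distrib)
  next
    case (basis k)
    show ?case
    proof (induction g rule: pm_induct)
      case (add g h)
      have sum: "vec (g + h) 0 = vec g 0 + vec h 0" by (simp add: vec_add)
      show ?case
        unfolding sum W_bracket_bilinear add
        by (simp add: vec_add D_add res_add distrib_left distrib_right add_diff_add)
    next
      case (scale c g)
      have scaled: "vec (const c * g) 0 = pm_scale c (vec g 0)" by (simp add: vec_scale)
      show ?case
        unfolding pm_scale_eq_const_mult[of c g] scaled W_bracket_bilinear scale
        by (simp add: vec_scale D_const_mult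
              res_const_mult mult.left_commute[of _ "const c"] right_diff_distrib)
    next
      case (basis l)
      obtain \<alpha> i \<beta> j where kl: "k = (\<alpha>, i)" "l = (\<beta>, j)" by (metis surj_pair)
      let ?f = "Poly_Mapping.single (\<alpha>, i) (1 :: complex)"
      let ?g = "Poly_Mapping.single (\<beta>, j) (1 :: complex)"
      let ?m = "Poly_Mapping.single (\<alpha> + \<beta>, i + j) (\<beta> - \<alpha>) +
          Poly_Mapping.single (\<alpha> + \<beta>, i + j - 1) (of_int (j - i))"
      have m: "?f * D ?g - D ?f * ?g = ?m"
        by (rule poly_mapping_eqI)
          (simp add: D_single mult_single distrib_left distrib_right lookup_add lookup_minus
             lookup_single when_def add_diff_eq diff_add_eq)
      have neg: "\<alpha> + \<beta> = 0 \<longleftrightarrow> \<alpha> = - \<beta>"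
        by (simp add: eq_neg_iff_add_eq_0)
      have c: "res (D (D (D ?f)) * ?g) = W_cocycle \<alpha> i \<beta> j"
        by (auto simp: res_def D_single D_add mult_single distrib_right lookup_add W_cocycle_def
             lookup_single when_def neg power3_eq_cube power2_eq_square)
      have "vec ?m s = pm_scale (\<beta> - \<alpha>) (L (\<alpha> + \<beta>) (i + j))
          + pm_scale (of_int (j - i)) (L (\<alpha> + \<beta>) (i + j - 1)) + pm_scale s C" for s
        by (simp add: vec_def pm_extend_add)
      then show ?case
        unfolding kl m c by (simp add: vec_single W_bracket_L_L)
    qed
  qed
  then show ?thesis by (simp only: red)
qed

section \<open>The function part of the carrier: exponents restricted to \<open>G\<close>\<close>

definition exponents_in :: "complex set \<Rightarrow> exp_laurent set" where
  "exponents_in G = {f. \<forall>\<alpha> i. Poly_Mapping.lookup f (\<alpha>, i) \<noteq> 0 \<longrightarrow> \<alpha> \<in> G}"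

lemma vec_in_carrier:
  assumes "f \<in> exponents_in G"
  shows "vec f s \<in> W_carrier G"
  unfolding W_carrier_def vec_def pm_extend_def
proof (intro pm.span_add pm.span_sum pm.span_scale pm.span_base)
  fix k assume "k \<in> Poly_Mapping.keys f"
  then show "(case k of (\<alpha>, i) \<Rightarrow> L \<alpha> i) \<in> {L \<alpha> i | \<alpha> i. \<alpha> \<in> G} \<union> {C}"
    using assms by (cases k) (auto simp: exponents_in_def in_keys_iff)
qed simp

lemma exponents_in_add: "f \<in> exponents_in G \<Longrightarrow> g \<in> exponents_in G \<Longrightarrow> f + g \<in> exponents_in G"
  by (auto simp: exponents_in_def lookup_add) (metis add.right_neutral)

lemma exponents_in_const_mult: "f \<in> exponents_in G \<Longrightarrow> const c * f \<in> exponents_in G"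
  by (auto simp: exponents_in_def)

lemma exponents_in_single: "\<alpha> \<in> G \<Longrightarrow> Poly_Mapping.single (\<alpha>, i) c \<in> exponents_in G"
  by (auto simp: exponents_in_def lookup_single when_def split: if_splits)

lemma exponents_in_expo: "\<alpha> \<in> G \<Longrightarrow> expo \<alpha> \<in> exponents_in G"
  by (simp add: expo_def exponents_in_single)

lemma exponents_in_uminus: "f \<in> exponents_in G \<Longrightarrow> - f \<in> exponents_in G"
  by (simp add: exponents_in_def)

lemma exponents_in_diff: "f \<in> exponents_in G \<Longrightarrow> g \<in> exponents_in G \<Longrightarrow> f - g \<in> exponents_in G"
  using exponents_in_add[of f G "- g"] by (simp add: exponents_in_uminus)

lemma exponents_in_D: "f \<in> exponents_in G \<Longrightarrow> D f \<in> exponents_in G"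
  by (auto simp: exponents_in_def lookup_D) (metis add.right_neutral mult_zero_right)

lemma exponents_in_mult:
  assumes "\<And>\<alpha> \<beta>. \<alpha> \<in> G \<Longrightarrow> \<beta> \<in> G \<Longrightarrow> \<alpha> + \<beta> \<in> G"
    and f: "f \<in> exponents_in G" and g: "g \<in> exponents_in G"
  shows "f * g \<in> exponents_in G"
  unfolding exponents_in_def
proof (clarify)
  fix \<alpha> i assume "Poly_Mapping.lookup (f * g) (\<alpha>, i) \<noteq> 0"
  then have "(\<alpha>, i) \<in> Poly_Mapping.keys (f * g)" by (simp add: in_keys_iff)
  then obtain \<beta> j \<gamma> k where "(\<beta>, j) \<in> Poly_Mapping.keys f" "(\<gamma>, k) \<in> Poly_Mapping.keys g" "\<alpha> = \<beta> + \<gamma>"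
    using keys_mult[of f g] by fastforce
  then have "\<beta> \<in> G" "\<gamma> \<in> G"
    using f g by (auto simp: exponents_in_def in_keys_iff)
  with \<open>\<alpha> = \<beta> + \<gamma>\<close> show "\<alpha> \<in> G" using assms(1) by simp
qed

lemma proj_in_exponents:
  assumes "w \<in> W_carrier G"
  shows "proj w \<in> exponents_in G"
  using assms unfolding W_carrier_def
proof (induction rule: pm.span_induct_alt)
  case base
  then show ?case by (simp add: proj_def exponents_in_def)
next
  case (step c x y)
  then have "proj x \<in> exponents_in G"
    by (auto simp: proj_L exponents_in_single) (simp add: exponents_in_def)
  with step show ?case
    by (simp add: proj_add proj_scale exponents_in_add exponents_in_const_mult)
qed

text \<open>Pairing with \<open>e^(- \<beta> t) t^(-1 - j)\<close> reads off the coefficient of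
  \<open>f\<close> at \<open>(\<beta>, j)\<close>; closure under negation keeps this test function
  admissible.\<close>

lemma res_pairing_nondegenerate:
  assumes "\<And>\<alpha>. \<alpha> \<in> G \<Longrightarrow> - \<alpha> \<in> G" and f: "f \<in> exponents_in G"
    and "\<And>g. g \<in> exponents_in G \<Longrightarrow> res (f * g) = 0"
  shows "f = 0"
proof (rule poly_mapping_eqI)
  fix k :: "complex \<times> int"
  obtain \<beta> j where k: "k = (\<beta>, j)" by (cases k)
  show "Poly_Mapping.lookup f k = Poly_Mapping.lookup 0 k"
  proof (cases "\<beta> \<in> G")
    case True
    then have "Poly_Mapping.single (- \<beta>, - 1 - j) 1 \<in> exponents_in G"
      by (simp add: assms(1) exponents_in_single)
    from assms(3)[OF this] show ?thesis
      by (simp add: res_def lookup_mult_single k)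
  next
    case False
    then show ?thesis using f by (auto simp: exponents_in_def k)
  qed
qed

section \<open>Half-derivations\<close>

locale W_half_derivation =
  fixes G :: "complex set" and \<phi> :: "(W_index \<Rightarrow>\<^sub>0 complex) \<Rightarrow> (W_index \<Rightarrow>\<^sub>0 complex)"
  assumes G_0: "0 \<in> G"
    and G_add: "\<And>\<alpha> \<beta>. \<alpha> \<in> G \<Longrightarrow> \<beta> \<in> G \<Longrightarrow> \<alpha> + \<beta> \<in> G"
    and G_uminus: "\<And>\<alpha>. \<alpha> \<in> G \<Longrightarrow> - \<alpha> \<in> G"
    and G_nontrivial: "G \<noteq> {0}"
    and half_derivation: "complex_lie_algebra.half_derivation pm_scale (W_carrier G) W_bracket \<phi>"
begin

sublocale complex_lie_algebra pm_scale "W_carrier G" W_bracket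
  by (rule complex_lie_algebra_W) (rule G_add)

abbreviation "S \<equiv> exponents_in G"

section \<open>Function part and central part of a half-derivation\<close>

definition "P f = proj (\<phi> (vec f 0))"
definition "\<omega> f = central (\<phi> (vec f 0))"
text \<open>This turns out in \<open>phi_eq_scale\<close> to be the scalar by which
  \<open>\<phi>\<close> acts.\<close>

definition "c = central (\<phi> C)"

lemma phi:
  "x \<in> W_carrier G \<Longrightarrow> \<phi> x \<in> W_carrier G"
  "x \<in> W_carrier G \<Longrightarrow> y \<in> W_carrier G \<Longrightarrow> \<phi> (x + y) = \<phi> x + \<phi> y"
  "x \<in> W_carrier G \<Longrightarrow> \<phi> (pm_scale d x) = pm_scale d (\<phi> x)"
  "x \<in> W_carrier G \<Longrightarrow> y \<in> W_carrier G \<Longrightarrow>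
     \<phi> (W_bracket x y) = pm_scale (1/2) (W_bracket (\<phi> x) y + W_bracket x (\<phi> y))"
  using half_derivation by (auto simp: half_derivation_def linear_endo_def)

lemma const_in_S: "const d \<in> S"
  using exponents_in_single[OF G_0, of 0 d] by (simp add: const_def zero_prod_def)

lemmas S_rules = const_in_S exponents_in_add exponents_in_diff exponents_in_uminus exponents_in_const_mult
  exponents_in_D exponents_in_expo exponents_in_mult[OF G_add] G_uminus vec_in_carrier

lemma one_in_S: "1 \<in> S"
  using exponents_in_expo[OF G_0] by simp

lemma G_nonzero: obtains \<alpha> where "\<alpha> \<in> G" "\<alpha> \<noteq> 0"
  using G_0 G_nontrivial by auto

lemma phi_vec_0: "\<phi> (vec f 0) = vec (P f) (\<omega> f)"
  by (simp add: P_def \<omega>_def vec_proj_central)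

lemma P_in_S: "f \<in> S \<Longrightarrow> P f \<in> S"
  by (simp add: P_def proj_in_exponents phi vec_in_carrier)

lemma P_linear:
  "f \<in> S \<Longrightarrow> g \<in> S \<Longrightarrow> P (f + g) = P f + P g"
  "f \<in> S \<Longrightarrow> P (const d * f) = const d * P f"
  "f \<in> S \<Longrightarrow> g \<in> S \<Longrightarrow> \<omega> (f + g) = \<omega> f + \<omega> g"
  "f \<in> S \<Longrightarrow> \<omega> (const d * f) = d * \<omega> f"
  using phi(2)[OF vec_in_carrier vec_in_carrier, of f g 0 0] phi(3)[OF vec_in_carrier, of f d 0]
  by (simp_all add: vec_add vec_scale phi_vec_0)

lemma C_in_carrier: "C \<in> W_carrier G"
  by (simp add: W_carrier_def pm.span_base)

text \<open>\<open>C\<close> brackets to \<open>0\<close> with everything, hence so does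
  \<open>\<phi> C\<close>. Its function part \<open>u\<close> has \<open>D u = 0\<close> by testing
  against \<open>1\<close>, and then \<open>u = 0\<close> by testing against
  \<open>expo \<alpha>\<close> with \<open>\<alpha> \<noteq> 0\<close>.\<close>

lemma phi_C: "\<phi> C = vec 0 c"
proof -
  obtain \<alpha> where \<alpha>: "\<alpha> \<in> G" "\<alpha> \<noteq> 0" by (rule G_nonzero)
  let ?u = "proj (\<phi> C)"
  have "W_bracket (vec ?u c) (vec g 0) = 0" if "g \<in> S" for g
    \<comment> \<open>Scalar \<open>0\<close> in \<open>phi(3)\<close> gives
      \<open>\<phi> 0 = 0\<close>.\<close>
    using phi(4)[OF C_in_carrier vec_in_carrier[OF that, of 0]] phi(3)[OF C_in_carrier, of 0]
    by (simp add: c_def vec_proj_central)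
  then have u: "?u * D g - D ?u * g = 0" if "g \<in> S" for g
    using that by (metis W_bracket_vec proj_vec proj_C mult_zero_right proj_scale pm.scale_zero_left)
  have "D ?u = 0"
    using u[OF one_in_S] by simp
  then have "?u * (const \<alpha> * expo \<alpha>) = 0"
    using u[OF exponents_in_expo[OF \<alpha>(1)]] by (simp add: D_expo)
  then have "?u * (const \<alpha> * expo \<alpha>) * expo (- \<alpha>) = 0" by simp
  then have "const \<alpha> * (?u * (expo \<alpha> * expo (- \<alpha>))) = 0" by (simp only: mult_ac)
  then have "?u = 0" using \<alpha> by (simp add: expo_mult_cancel)
  then show ?thesis using vec_proj_central[of "\<phi> C"] by (simp add: c_def)
qed

lemma phi_vec:
  assumes "f \<in> S"
  shows "\<phi> (vec f s) = vec (P f) (\<omega> f + s * c)"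
proof -
  have sum: "vec f s = vec f 0 + pm_scale s C"
    by (simp add: vec_def)
  have "\<phi> (vec f s) = \<phi> (vec f 0) + pm_scale s (\<phi> C)"
    using phi(2)[OF vec_in_carrier[OF assms] pm.subspace_scale[OF subspace_carrier C_in_carrier]] phi(3)[OF C_in_carrier]
    unfolding sum by simp
  then show ?thesis
    by (simp add: phi_C vec_scale vec_add phi_vec_0)
qed

text \<open>The two coordinates of the half-derivation identity, with the factor \<open>1/2\<close>
  cleared. The term with \<open>c\<close> is the image of the central part of the bracket.\<close>

lemma bracket_components:
  assumes "f \<in> S" "g \<in> S"
  shows "const 2 * P (f * D g - D f * g) =
      (P f * D g - D (P f) * g) + (f * D (P g) - D f * P g)" (is ?P)
    and "2 * (\<omega> (f * D g - D f * g) + c * res (D (D (D f)) * g)) =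
      res (D (D (D (P f))) * g) + res (D (D (D f)) * P g)" (is ?O)
proof -
  have "\<phi> (W_bracket (vec f 0) (vec g 0)) =
      pm_scale (1/2) (W_bracket (\<phi> (vec f 0)) (vec g 0) + W_bracket (vec f 0) (\<phi> (vec g 0)))"
    by (intro phi vec_in_carrier assms)
  moreover have "f * D g - D f * g \<in> S" by (intro S_rules assms)
  ultimately have "vec (P (f * D g - D f * g)) (\<omega> (f * D g - D f * g) + res (D (D (D f)) * g) * c) =
      pm_scale (1/2) (vec ((P f * D g - D (P f) * g) + (f * D (P g) - D f * P g))
         (res (D (D (D (P f))) * g) + res (D (D (D f)) * P g)))"
    by (simp only: W_bracket_vec phi_vec vec_add assms)
  then have eq: "P (f * D g - D f * g) = const (1/2) * ((P f * D g - D (P f) * g) + (f * D (P g) - D f * P g))"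
    and eq': "\<omega> (f * D g - D f * g) + res (D (D (D f)) * g) * c =
      1/2 * (res (D (D (D (P f))) * g) + res (D (D (D f)) * P g))"
    by (simp_all only: vec_scale vec_eq_iff)
  show ?P
    unfolding eq mult.assoc[symmetric] const_mult[symmetric] by simp
  show ?O
    using eq' by (simp add: algebra_simps)
qed

section \<open>Vanishing of the deviation \<open>\<psi>\<close> from multiplication by
  \<open>P 1\<close>\<close>

definition "\<psi> f = P f - P 1 * f"

lemma psi_linear:
  "f \<in> S \<Longrightarrow> g \<in> S \<Longrightarrow> \<psi> (f + g) = \<psi> f + \<psi> g"
  "f \<in> S \<Longrightarrow> \<psi> (const d * f) = const d * \<psi> f"
  by (simp_all add: \<psi>_def P_linear distrib_left right_diff_distrib mult.left_commute)

lemma psi_diff: "f \<in> S \<Longrightarrow> g \<in> S \<Longrightarrow> \<psi> (f - g) = \<psi> f - \<psi> g"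
  using psi_linear(1)[of f "const (-1) * g"] psi_linear(2)[of g "-1"]
  by (simp add: exponents_in_uminus const_uminus)

lemma psi_1: "\<psi> 1 = 0"
  by (simp add: \<psi>_def)

text \<open>Multiplication by \<open>a = P 1\<close> satisfies the same identity, because the terms
  with \<open>D a\<close> cancel; subtracting it from the identity for \<open>P\<close> leaves the
  one for \<open>\<psi>\<close>.\<close>

lemma psi_bracket:
  assumes "f \<in> S" "g \<in> S"
  shows "const 2 * \<psi> (f * D g - D f * g) =
      (\<psi> f * D g - D (\<psi> f) * g) + (f * D (\<psi> g) - D f * \<psi> g)"
  using bracket_components(1)[OF assms]
  by (simp add: \<psi>_def D_rules const_numeral algebra_simps)

lemma psi_D: "g \<in> S \<Longrightarrow> const 2 * \<psi> (D g) = D (\<psi> g)"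
  using psi_bracket[OF one_in_S, of g] by (simp add: psi_1)

lemma psi_expo:
  assumes "\<alpha> \<in> G"
  shows "\<psi> (expo \<alpha>) = 0"
proof (cases "\<alpha> = 0")
  case True
  then show ?thesis by (simp add: psi_1)
next
  case False
  have eig: "\<exists>k. \<psi> (expo \<beta>) = const k * expo (2 * \<beta>)" if "\<beta> \<in> G" for \<beta>
  proof -
    have "D (\<psi> (expo \<beta>)) = const (2 * \<beta>) * \<psi> (expo \<beta>)"
      using psi_D[of "expo \<beta>"] that
      by (simp add: exponents_in_expo D_expo psi_linear const_mult mult.assoc)
    then show ?thesis by (metis D_eigenvector)
  qed
  obtain k l where k: "\<psi> (expo \<alpha>) = const k * expo (2 * \<alpha>)"
    and l: "\<psi> (expo (- \<alpha>)) = const l * expo (2 * - \<alpha>)"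
    using eig assms G_uminus by meson
  \<comment> \<open>The bracket is the constant \<open>-2 \<alpha>\<close>, and
    \<open>\<psi>\<close> kills constants, so the right side of \<open>psi_bracket\<close> must
    vanish.\<close>
  have "expo \<alpha> * D (expo (- \<alpha>)) - D (expo \<alpha>) * expo (- \<alpha>) = const (- 2 * \<alpha>) * (expo \<alpha> * expo (- \<alpha>))"
    by (simp add: D_expo const_hom algebra_simps)
  then have "\<psi> (expo \<alpha> * D (expo (- \<alpha>)) - D (expo \<alpha>) * expo (- \<alpha>)) = const (-2 * \<alpha>) * \<psi> 1"
    by (simp only: expo_mult_cancel psi_linear one_in_S)
  then have "(\<psi> (expo \<alpha>) * D (expo (- \<alpha>)) - D (\<psi> (expo \<alpha>)) * expo (- \<alpha>)) +
      (expo \<alpha> * D (\<psi> (expo (- \<alpha>))) - D (expo \<alpha>) * \<psi> (expo (- \<alpha>))) = 0"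
    using psi_bracket[of "expo \<alpha>" "expo (- \<alpha>)"] assms by (simp add: S_rules psi_1)
  then have "const (- 3 * \<alpha> * k) * expo (2 * \<alpha> + - \<alpha>) + const (- 3 * \<alpha> * l) * expo (\<alpha> + 2 * - \<alpha>) = 0"
    unfolding k l expo_add by (simp add: D_rules const_hom algebra_simps)
  \<comment> \<open>The coefficient at \<open>(\<alpha>, 0)\<close> isolates \<open>k\<close>, since
    \<open>expo (- \<alpha>)\<close> has none there.\<close>
  then have "Poly_Mapping.lookup (const (- 3 * \<alpha> * k) * expo \<alpha> + const (- 3 * \<alpha> * l) * expo (- \<alpha>)) (\<alpha>, 0) = 0"
    by simp
  moreover have "- \<alpha> \<noteq> \<alpha>" using False by (simp add: neg_eq_iff_add_eq_0)
  ultimately have "k = 0"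
    using False by (simp add: lookup_add expo_def lookup_single)
  then show ?thesis by (simp add: k)
qed

text \<open>\<open>4 \<psi> v\<close> is evaluated twice: by pulling both brackets through
  \<open>\<psi>\<close>, which kills \<open>expo \<alpha>\<close> and
  \<open>expo (- \<alpha>)\<close>, and termwise by \<open>psi_D\<close>. The terms
  \<open>D (D h)\<close> cancel, and the difference is
  \<open>\<alpha> (D h + 6 \<alpha> h)\<close>.\<close>

lemma psi_D_eigen:
  assumes g: "g \<in> S" and \<alpha>: "\<alpha> \<in> G" "\<alpha> \<noteq> 0"
  shows "D (\<psi> g) = const (- 6 * \<alpha>) * \<psi> g"
proof -
  define h where "h = \<psi> g"
  \<comment> \<open>\<open>u\<close> and \<open>v\<close> are \<open>[e\<^bsup>-\<alpha>t\<^esup>, g]\<close> and \<open>[e\<^bsup>\<alpha>t\<^esup>, u]\<close> modulo the centre.\<close>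
  define u where "u = expo (- \<alpha>) * (D g + const \<alpha> * g)"
  define v where "v = D (D g) - const \<alpha> * D g - const (2 * \<alpha>\<^sup>2) * g"
  have uS: "u \<in> S" unfolding u_def by (intro S_rules g \<alpha>)
  have u: "expo (- \<alpha>) * D g - D (expo (- \<alpha>)) * g = u"
    by (simp add: u_def D_expo const_hom algebra_simps)
  have pu: "const 2 * \<psi> u = expo (- \<alpha>) * (D h + const \<alpha> * h)"
    using psi_bracket[of "expo (- \<alpha>)" g] g \<alpha> unfolding u
    by (simp add: S_rules psi_expo D_expo h_def const_hom algebra_simps)
  \<comment> \<open>Conjugation by the exponential turns \<open>D\<close> into
    \<open>D - \<alpha>\<close>.\<close>
  have shift: "expo \<alpha> * D (expo (- \<alpha>) * f) = D f - const \<alpha> * f" for f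
  proof -
    have "expo \<alpha> * D (expo (- \<alpha>) * f) = (expo \<alpha> * expo (- \<alpha>)) * (D f - const \<alpha> * f)"
      by (simp add: D_rules const_hom algebra_simps)
    then show ?thesis by (simp add: expo_mult_cancel)
  qed
  have two: "expo \<alpha> * D (expo (- \<alpha>) * f) - D (expo \<alpha>) * (expo (- \<alpha>) * f) = D f - const (2 * \<alpha>) * f" for f
  proof -
    have "D (expo \<alpha>) * (expo (- \<alpha>) * f) = const \<alpha> * (expo \<alpha> * expo (- \<alpha>)) * f"
      by (simp add: D_expo mult.assoc)
    then show ?thesis by (simp add: expo_mult_cancel shift const_hom)
  qed
  have v: "expo \<alpha> * D u - D (expo \<alpha>) * u = v"
    unfolding u_def two by (simp add: v_def D_rules const_hom algebra_simps power2_eq_square)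
  have "const 2 * \<psi> v = expo \<alpha> * D (\<psi> u) - D (expo \<alpha>) * \<psi> u"
    using psi_bracket[of "expo \<alpha>" u] uS \<alpha> unfolding v by (simp add: S_rules psi_expo)
  then have "const 2 * (const 2 * \<psi> v) = expo \<alpha> * D (const 2 * \<psi> u) - D (expo \<alpha>) * (const 2 * \<psi> u)"
    by (simp add: D_const_mult right_diff_distrib mult.left_commute)
  then have 1: "const 2 * (const 2 * \<psi> v) = D (D h) - const \<alpha> * D h - const (2 * \<alpha>\<^sup>2) * h"
    unfolding pu two by (simp add: D_rules const_hom algebra_simps power2_eq_square)
  have pv: "\<psi> v = \<psi> (D (D g)) - const \<alpha> * \<psi> (D g) - const (2 * \<alpha>\<^sup>2) * h"
    unfolding v_def h_def by (simp add: psi_diff psi_linear S_rules g)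
  have "const 2 * (const 2 * \<psi> v) =
      const 2 * (const 2 * \<psi> (D (D g))) - const (2 * \<alpha>) * (const 2 * \<psi> (D g)) - const (8 * \<alpha>\<^sup>2) * h"
    unfolding pv by (simp add: const_hom algebra_simps)
  also have "const 2 * (const 2 * \<psi> (D (D g))) = D (D h)"
    using g by (simp add: psi_D S_rules h_def flip: D_const_mult)
  also have "const 2 * \<psi> (D g) = D h"
    using g by (simp add: psi_D h_def)
  finally have 2: "const 2 * (const 2 * \<psi> v) =
      D (D h) - const (2 * \<alpha>) * D h - const (8 * \<alpha>\<^sup>2) * h" .
  have "const \<alpha> * (D h - const (- 6 * \<alpha>) * h) =
      (D (D h) - const \<alpha> * D h - const (2 * \<alpha>\<^sup>2) * h)
      - (D (D h) - const (2 * \<alpha>) * D h - const (8 * \<alpha>\<^sup>2) * h)"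
    by (simp add: const_hom algebra_simps power2_eq_square)
  also have "\<dots> = 0"
    by (simp flip: 1 2)
  finally have "const \<alpha> * (D h - const (- 6 * \<alpha>) * h) = 0" .
  then show ?thesis using \<alpha> by (simp add: h_def)
qed

lemma P_eq:
  assumes g: "g \<in> S"
  shows "P g = P 1 * g"
proof -
  obtain \<alpha> where \<alpha>: "\<alpha> \<in> G" "\<alpha> \<noteq> 0" by (rule G_nonzero)
  have "const (- 6 * \<alpha>) * \<psi> g = const (- 6 * - \<alpha>) * \<psi> g"
    using psi_D_eigen[OF g, of \<alpha>] psi_D_eigen[OF g, of "- \<alpha>"] \<alpha> G_uminus by simp
  then have "const (- 12 * \<alpha>) * \<psi> g = 0"
    by (simp add: const_hom algebra_simps)
  then show ?thesis using \<alpha> by (simp add: \<psi>_def)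
qed

section \<open>The central component\<close>

lemma omega_diff: "f \<in> S \<Longrightarrow> g \<in> S \<Longrightarrow> \<omega> (f - g) = \<omega> f - \<omega> g"
  using P_linear(3)[of f "const (-1) * g"] P_linear(4)[of g "-1"]
  by (simp add: exponents_in_uminus const_uminus)

text \<open>The central coordinate of the identity for \<open>expo \<alpha>\<close> and
  \<open>u\<close>, the function part of \<open>[expo (- \<alpha>), g]\<close>, now that
  \<open>P\<close> is multiplication by \<open>a = P 1\<close>. Integration by parts moves the
  derivatives onto \<open>a\<close>, where those of order two and four cancel. Only the first two
  terms on the right are odd in \<open>\<alpha>\<close>.\<close>

lemma omega_eq:
  assumes g: "g \<in> S" and \<alpha>: "\<alpha> \<in> G"
  shows "- 4 * \<alpha>\<^sup>2 * \<omega> g + 2 * c * \<alpha> ^ 4 * res g =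
    \<alpha> ^ 3 * res (D (P 1) * g) - \<alpha> * res (D (D (D (P 1))) * g) + 2 * \<alpha> ^ 4 * res (P 1 * g)"
proof -
  define a where "a = P 1"
  define u where "u = expo (- \<alpha>) * (D g + const \<alpha> * g)"
  \<comment> \<open>Chosen so that the double bracket is \<open>D v - 2 \<alpha>^2 g\<close>; then
    \<open>\<omega> (D v)\<close> can be computed by bracketing \<open>1\<close> with
    \<open>v\<close>.\<close>
  define v where "v = D g - const \<alpha> * g"
  have uS: "u \<in> S" and vS: "v \<in> S" by (simp_all add: u_def v_def S_rules g \<alpha>)
  have cancel: "expo \<alpha> * (expo (- \<alpha>) * f) = f" for f
    by (simp add: expo_mult_cancel flip: mult.assoc)
  have U: "expo \<alpha> * u = D g + const \<alpha> * g"
    by (simp add: u_def cancel)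
  have bracket: "expo \<alpha> * D u - D (expo \<alpha>) * u = D v - const (2 * \<alpha>\<^sup>2) * g"
  proof -
    have "expo \<alpha> * D u - D (expo \<alpha>) * u = D (expo \<alpha> * u) - const (2 * \<alpha>) * (expo \<alpha> * u)"
      by (simp add: D_rules const_hom algebra_simps)
    then show ?thesis
      unfolding U by (simp add: v_def D_rules const_hom algebra_simps power2_eq_square)
  qed
  have cube: "D (D (D (expo \<alpha>))) = const (\<alpha> ^ 3) * expo \<alpha>"
    by (simp add: D_rules const_hom power3_eq_cube algebra_simps)
  have acube: "D (D (D (a * expo \<alpha>))) =
      (const (\<alpha> ^ 3) * a + const (3 * \<alpha>\<^sup>2) * D a + const (3 * \<alpha>) * D (D a) + D (D (D a))) * expo \<alpha>"
    by (simp add: D_rules const_hom power3_eq_cube power2_eq_square algebra_simps)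
  define w where "w = D g + const \<alpha> * g"
  have "2 * (\<omega> (D v - const (2 * \<alpha>\<^sup>2) * g) + c * res (const (\<alpha> ^ 3) * w)) =
     res ((const (\<alpha> ^ 3) * a + const (3 * \<alpha>\<^sup>2) * D a + const (3 * \<alpha>) * D (D a) + D (D (D a))) * w)
       + res (const (\<alpha> ^ 3) * (a * w))"
    using bracket_components(2)[OF exponents_in_expo[OF \<alpha>] uS]
    unfolding bracket P_eq[OF exponents_in_expo[OF \<alpha>]] P_eq[OF uS] a_def[symmetric] acube
    unfolding cube mult.assoc U mult.left_commute[of _ a] w_def .
  moreover have "\<omega> (D v - const (2 * \<alpha>\<^sup>2) * g) = \<omega> (D v) - 2 * \<alpha>\<^sup>2 * \<omega> g"
    by (simp add: omega_diff P_linear S_rules g vS)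
  moreover have "2 * \<omega> (D v) = res (D (D (D a)) * v)"
    using bracket_components(2)[OF one_in_S vS] by (simp add: a_def res_def)
  moreover have "res (f * w) = \<alpha> * res (f * g) - res (D f * g)"
    "res (f * v) = - \<alpha> * res (f * g) - res (D f * g)" for f
    by (simp_all add: w_def v_def distrib_left right_diff_distrib res_add res_diff res_D_mult
         mult.left_commute[of f "const \<alpha>"] res_const_mult)
  moreover have "res w = \<alpha> * res g"
    by (simp add: w_def res_add res_const_mult)
  ultimately show ?thesis
    unfolding a_def[symmetric]
    by (simp add: distrib_right res_add mult.assoc res_const_mult)
       (simp add: algebra_simps power2_eq_square power3_eq_cube power4_eq_xxxx)
qed

lemma phi_eq_scale:
  assumes "x \<in> W_carrier G"
  shows "\<phi> x = pm_scale c x"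
proof -
  obtain \<alpha> where \<alpha>: "\<alpha> \<in> G" "\<alpha> \<noteq> 0" by (rule G_nonzero)
  have G: "- \<alpha> \<in> G" "2 * \<alpha> \<in> G" "- (2 * \<alpha>) \<in> G"
    using \<alpha> G_uminus G_add[of \<alpha> \<alpha>] by simp_all
  have "res (D (P 1) * g) = 0" if g: "g \<in> S" for g
  proof -
    define r s where "r = \<alpha> ^ 3 * res (D (P 1) * g)" and "s = \<alpha> * res (D (D (D (P 1))) * g)"
    \<comment> \<open>Subtracting \<open>omega_eq\<close> at \<open>\<alpha>\<close> and
      \<open>- \<alpha>\<close> leaves the odd terms; doing the same at \<open>2 \<alpha>\<close>
      scales the cubic one by \<open>8\<close> and the linear one by \<open>2\<close>.\<close>
    have "r = s"
      using omega_eq[OF g \<alpha>(1)] omega_eq[OF g G(1)] by (simp add: r_def s_def)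
    moreover have "8 * r = 2 * s"
      using omega_eq[OF g G(2)] omega_eq[OF g G(3)] by (simp add: r_def s_def power_mult_distrib)
    ultimately show ?thesis using \<alpha> by (simp add: r_def)
  qed
  then have "D (P 1) = 0"
    using res_pairing_nondegenerate[OF G_uminus exponents_in_D[OF P_in_S[OF one_in_S]]] by blast
  \<comment> \<open>Eigenvalue \<open>0\<close> means a multiple of
    \<open>expo 0 = 1\<close>.\<close>
  then obtain k where k: "P 1 = const k"
    using D_eigenvector[of "P 1" 0] by auto
  have om: "- 4 * \<beta>\<^sup>2 * \<omega> g + 2 * c * \<beta> ^ 4 * res g = 2 * \<beta> ^ 4 * k * res g"
    if "g \<in> S" "\<beta> \<in> G" for g \<beta>
    using omega_eq[OF that] by (simp add: k res_const_mult)
  have om2: "\<omega> g = 0 \<and> (c - k) * res g = 0" if g: "g \<in> S" for g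
  proof -
    define \<tau> where "\<tau> = (c - k) * res g"
    have *: "2 * \<omega> g = \<beta>\<^sup>2 * \<tau>" if "\<beta> \<in> G" "\<beta> \<noteq> 0" for \<beta>
    proof -
      have "2 * \<beta>\<^sup>2 * (2 * \<omega> g - \<beta>\<^sup>2 * \<tau>) = 0"
        using om[OF g that(1)] by (simp add: \<tau>_def algebra_simps power2_eq_square power4_eq_xxxx)
      then show ?thesis using that by simp
    qed
    \<comment> \<open>\<open>\<omega> g\<close> does not depend on \<open>\<beta>\<close>, so
      \<open>\<beta> = \<alpha>\<close> and \<open>\<beta> = 2 \<alpha>\<close> together force
      \<open>\<tau> = 0\<close>.\<close>
    have "\<alpha>\<^sup>2 * \<tau> = (2 * \<alpha>)\<^sup>2 * \<tau>"
      using *[of \<alpha>] *[of "2 * \<alpha>"] \<alpha> G by simp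
    then have "\<tau> = 0" using \<alpha> by (simp add: power_mult_distrib)
    with *[of \<alpha>] \<alpha> have "\<omega> g = 0" by simp
    with \<open>\<tau> = 0\<close> show ?thesis by (simp add: \<tau>_def)
  qed
  \<comment> \<open>\<open>t^(-1)\<close> has residue \<open>1\<close>, which turns
    \<open>(c - k) * res g = 0\<close> into \<open>k = c\<close>.\<close>
  have "Poly_Mapping.single (0, -1) 1 \<in> S"
    by (rule exponents_in_single) (rule G_0)
  from om2[OF this] have "k = c"
    by (simp add: res_def)
  then have "\<phi> (vec f s) = pm_scale c (vec f s)" if "f \<in> S" for f s
    using om2[OF that] that by (simp add: phi_vec P_eq[of f] k vec_scale)
  then show ?thesis
    using proj_in_exponents[OF assms] vec_proj_central[of x] by metis
qed

end

section \<open>Determination of all half-derivations\<close>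

theorem theorem15:
  fixes G :: "complex set"
  assumes "0 \<in> G"
    and "\<And>\<alpha> \<beta>. \<alpha> \<in> G \<Longrightarrow> \<beta> \<in> G \<Longrightarrow> \<alpha> + \<beta> \<in> G"
    and "\<And>\<alpha>. \<alpha> \<in> G \<Longrightarrow> - \<alpha> \<in> G"
    and "G \<noteq> {0}"
  shows "complex_lie_algebra.half_derivations pm_scale (W_carrier G) W_bracket =
           complex_lie_algebra.map_span pm_scale
             {complex_lie_algebra.id_endo (W_carrier G)} \<and>
         (\<forall>\<phi>. complex_lie_algebra.linear_endo pm_scale (W_carrier G) \<phi> \<longrightarrow>
            (complex_lie_algebra.half_derivation pm_scale (W_carrier G) W_bracket \<phi> \<longleftrightarrow>
             (\<exists>c. \<forall>x\<in>W_carrier G. \<phi> x = pm_scale c x)))"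
proof -
  interpret complex_lie_algebra pm_scale "W_carrier G" W_bracket
    by (rule complex_lie_algebra_W) (rule assms(2))
  have scalar: "\<exists>c. \<forall>x\<in>W_carrier G. \<phi> x = pm_scale c x" if "half_derivation \<phi>" for \<phi>
  proof -
    interpret W_half_derivation G \<phi>
      by (rule W_half_derivation.intro) (use assms that in auto)
    show ?thesis using phi_eq_scale by blast
  qed
  have half: "half_derivation \<phi>" if "\<And>x. x \<in> W_carrier G \<Longrightarrow> \<phi> x = pm_scale c x" for \<phi> c
  proof -
    have double: "pm_scale (d / 2) w + pm_scale (d / 2) w = pm_scale d w"
      for d and w :: "W_index \<Rightarrow>\<^sub>0 complex"
      by (simp flip: pm.scale_left_distrib)
    have "pm_scale d x \<in> W_carrier G" if "x \<in> W_carrier G" for d x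
      using that by (rule pm.subspace_scale[OF subspace_carrier])
    moreover have "x + y \<in> W_carrier G" if "x \<in> W_carrier G" "y \<in> W_carrier G" for x y
      using that by (rule pm.subspace_add[OF subspace_carrier])
    ultimately show ?thesis
      unfolding half_derivation_def linear_endo_def
      by (simp add: that bracket_closed bracket_scale_left bracket_scale_right double
          pm.scale_right_distrib mult.commute)
  qed
  interpret maps: vector_space "\<lambda>c (\<phi> :: (W_index \<Rightarrow>\<^sub>0 complex) \<Rightarrow> W_index \<Rightarrow>\<^sub>0 complex) x. pm_scale c (\<phi> x)"
    by (rule vector_space_maps)
  have "half_derivations = range (\<lambda>c x. pm_scale c (id_endo x))"
  proof (intro equalityI subsetI)
    fix \<phi> assume \<phi>: "\<phi> \<in> half_derivations"
    then obtain c where "\<forall>x\<in>W_carrier G. \<phi> x = pm_scale c x"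
      using scalar[of \<phi>] by (auto simp: half_derivations_def)
    \<comment> \<open>Both maps are \<open>0\<close> off the carrier, so agreement on it is
      equality.\<close>
    with \<phi> have "\<phi> = (\<lambda>x. pm_scale c (id_endo x))"
      by (auto simp: half_derivations_def id_endo_def fun_eq_iff)
    then show "\<phi> \<in> range (\<lambda>c x. pm_scale c (id_endo x))" by blast
  next
    fix \<phi> assume "\<phi> \<in> range (\<lambda>c x. pm_scale c (id_endo x))"
    then show "\<phi> \<in> half_derivations"
      by (auto simp: half_derivations_def id_endo_def intro!: half)
  qed
  then have "half_derivations = map_span {id_endo}"
    by (simp add: map_span_def maps.span_singleton)
  with scalar half show ?thesis by blast
qed

end
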